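(* Let $f:I\times J\to\mathbb{R}$ be the bivariate fractal interpolation function (FIF) determined by the IFS $\{K,W_{ij}:(i,j)\in\Sigma_N\times\Sigma_M\}$, where $W_{ij}(x,y,z)=(u_i(x),v_j(y),\alpha z+q_{ij}(x,y))$. Let $I_xf(x,y)=\int_a^x f(s,y)\,ds$. Then $I_xf$ is the FIF associated with $\{K,\hat W_{ij}:(i,j)\in\Sigma_N\times\Sigma_M\}$, where $$\hat W_{ij}(x,y,z)=(u_i(x),v_j(y),\hat F_{ij}(x,y,z)),$$ and $\hat F_{ij}:K\to\mathbb{R}$ is defined by $\hat F_{ij}(x,y,z)=\alpha a_i z+\hat q_{ij}(x,y)$ with $$\hat q_{ij}(x,y)=a_i\, I_xq_{ij}(x,y)+\int_a^{u_i(a)} f(s,v_j(y))\,ds .$$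
   Context: Let $I=[a,b]$, $J=[c,d]$, $K=I\times J\times\mathbb{R}$. Interpolation data $\{(x_i,y_j,z_{ij})\in\mathbb{R}^3: i=0,\dots,N;\ j=0,\dots,M\}$ are given with $a=x_0<x_1<\dots<x_N=b$ and $c=y_0<y_1<\dots<y_M=d$. Write $\Sigma_N=\{1,\dots,N\}$, $\Sigma_{N,0}=\{0,\dots,N\}$, $\partial\Sigma_{N,0}=\{0,N\}$, $\mathrm{int}\,\Sigma_{N,0}=\{1,\dots,N-1\}$, and similarly with $M$. Put $I_i=[x_{i-1},x_i]$, $J_j=[y_{j-1},y_j]$. For $i\in\Sigma_N$, $u_i:I\to I_i$ is the contractive affine homeomorphism $u_i(x)=a_ix+b_i$ with $u_i(x_0)=x_{i-1},\ u_i(x_N)=x_i$ if $i$ is odd and $u_i(x_0)=x_i,\ u_i(x_N)=x_{i-1}$ if $i$ is even; thus $a_i=\frac{x_i-x_{i-1}}{x_N-x_0}$, $b_i=\frac{x_{i-1}x_N-x_ix_0}{x_N-x_0}$ for $i$ odd and $a_i=\frac{x_{i-1}-x_i}{x_N-x_0}$, $b_i=\frac{x_ix_N-x_{i-1}x_0}{x_N-x_0}$ for $i$ even. For $j\in\Sigma_M$, $v_j:J\to J_j$ is the contractive affine homeomorphism $v_j(y)=c_jy+d_j$ with $v_j(y_0)=y_{j-1},\ v_j(y_M)=y_j$ if $j$ is odd and $v_j(y_0)=y_j,\ v_j(y_M)=y_{j-1}$ if $j$ is even; thus $c_j=\frac{y_j-y_{j-1}}{y_M-y_0}$ for $j$ odd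 and $c_j=\frac{y_{j-1}-y_j}{y_M-y_0}$ for $j$ even (with corresponding $d_j$). Define $\rho(i,0)=i-1$, $\rho(i,N)=\rho(i,M)=i$ for $i$ odd and $\rho(i,0)=i$, $\rho(i,N)=\rho(i,M)=i-1$ for $i$ even. Let $\alpha$ be a real constant with $|\alpha|<1$, and for each $(i,j)\in\Sigma_N\times\Sigma_M$ let $q_{ij}:I\times J\to\mathbb{R}$ be continuous with $q_{ij}(x_k,y_l)=z_{\rho(i,k),\rho(j,l)}-\alpha z_{kl}$ for all $(k,l)\in\partial\Sigma_{N,0}\times\partial\Sigma_{M,0}$. Put $F_{ij}(x,y,z)=\alpha z+q_{ij}(x,y)$ on $K$ and $W_{ij}(x,y,z)=(u_i(x),v_j(y),F_{ij}(x,y,z))$. The $F_{ij}$ satisfy the matching conditions: (1) for $i\in\mathrm{int}\,\Sigma_{N,0}$, $j\in\Sigma_M$ and $x^*=u_i^{-1}(x_i)=u_{i+1}^{-1}(x_i)$, $F_{ij}(x^*,y,z)=F_{i+1,j}(x^*,y,z)$ for all $y\in J,z\in\mathbb{R}$; (2) for $i\in\Sigma_N$, $j\in\mathrm{int}\,\Sigma_{M,0}$ and $y^*=v_j^{-1}(y_j)=v_{j+1}^{-1}(y_j)$, $F_{ij}(x,y^*,z)=F_{i,j+1}(x,y^*,z)$ for all $x\in I,z\in\mathbb{R}$. The FIF determined by $\{K,W_{ij}\}$ is the unique continuous $f:I\times J\to\mathbb{R}$ with $f(x_i,y_j)=z_{ij}$ for all $(i,j)\in\Sigma_{N,0}\times\Sigma_{M,0}$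 whose graph $G=\{(x,y,f(x,y)):(x,y)\in I\times J\}$ satisfies $G=\bigcup_{(i,j)\in\Sigma_N\times\Sigma_M}W_{ij}(G)$. Equivalently, $f(u_i(x),v_j(y))=F_{ij}(x,y,f(x,y))$ for all $(x,y)\in I\times J$ and all $(i,j)$. A continuous function $g$ on $I\times J$ is said to be the FIF associated with another IFS $\{K,\hat W_{ij}\}$ of the same form in the same sense, the interpolation data being the values of $g$ at the grid points. For a continuous function $g$ on $I\times J$, $I_xg(x,y)=\int_a^x g(s,y)\,ds$. *)

theory Defs
  imports "HOL-Analysis.Analysis"
begin

definition grid :: "real \<Rightarrow> real \<Rightarrow> nat \<Rightarrow> (nat \<Rightarrow> real) \<Rightarrow> bool" where
  "grid a b N X \<longleftrightarrow> 1 \<le> N \<and> X 0 = a \<and> X N = b \<and> (\<forall>i<N. X i < X (Suc i))"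

definition grid_rect :: "nat \<Rightarrow> nat \<Rightarrow> (nat \<Rightarrow> real) \<Rightarrow> (nat \<Rightarrow> real) \<Rightarrow> (real \<times> real) set" where
  "grid_rect N M X Y = {X 0..X N} \<times> {Y 0..Y M}"

text \<open>The affine maps \<open>u\<^sub>i\<close> (and, applied to the second grid, \<open>v\<^sub>j\<close>): they map
  the whole interval onto the \<open>i\<close>-th subinterval, preserving orientation for odd \<open>i\<close>
  and reversing it for even \<open>i\<close>.\<close>

definition grid_slope :: "nat \<Rightarrow> (nat \<Rightarrow> real) \<Rightarrow> nat \<Rightarrow> real" where
  "grid_slope N X i =
     (if odd i then (X i - X (i - 1)) / (X N - X 0) else (X (i - 1) - X i) / (X N - X 0))"

definition grid_icpt :: "nat \<Rightarrow> (nat \<Rightarrow> real) \<Rightarrow> nat \<Rightarrow> real" where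
  "grid_icpt N X i =
     (if odd i then (X (i - 1) * X N - X i * X 0) / (X N - X 0)
      else (X i * X N - X (i - 1) * X 0) / (X N - X 0))"

definition grid_map :: "nat \<Rightarrow> (nat \<Rightarrow> real) \<Rightarrow> nat \<Rightarrow> real \<Rightarrow> real" where
  "grid_map N X i t = grid_slope N X i * t + grid_icpt N X i"

text \<open>Only used with \<open>k\<close> the first index \<open>0\<close> or the last (positive) index of a grid;
  in the latter case the value does not depend on which grid is meant.\<close>

definition rho :: "nat \<Rightarrow> nat \<Rightarrow> nat" where
  "rho i k = (if odd i then (if k = 0 then i - 1 else i) else (if k = 0 then i else i - 1))"

definition vert_map ::
  "(nat \<Rightarrow> nat \<Rightarrow> real) \<Rightarrow> (nat \<Rightarrow> nat \<Rightarrow> real \<times> real \<Rightarrow> real) \<Rightarrow> nat \<Rightarrow> nat \<Rightarrow> real \<times> real \<times> real \<Rightarrow> real"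
  where "vert_map s q i j = (\<lambda>(x, y, z). s i j * z + q i j (x, y))"

definition ifs_map ::
  "nat \<Rightarrow> nat \<Rightarrow> (nat \<Rightarrow> real) \<Rightarrow> (nat \<Rightarrow> real) \<Rightarrow> (nat \<Rightarrow> nat \<Rightarrow> real \<times> real \<times> real \<Rightarrow> real)
   \<Rightarrow> nat \<Rightarrow> nat \<Rightarrow> real \<times> real \<times> real \<Rightarrow> real \<times> real \<times> real"
  where "ifs_map N M X Y F i j =
           (\<lambda>(x, y, z). (grid_map N X i x, grid_map M Y j y, F i j (x, y, z)))"

text \<open>The vertical scaling \<open>s\<close> may depend on \<open>(i, j)\<close>: it is a constant \<open>\<alpha>\<close> for the
  original IFS and \<open>\<alpha> a\<^sub>i\<close> for the integrated one.\<close>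

definition admissible_ifs ::
  "nat \<Rightarrow> nat \<Rightarrow> (nat \<Rightarrow> real) \<Rightarrow> (nat \<Rightarrow> real) \<Rightarrow> (nat \<Rightarrow> nat \<Rightarrow> real)
   \<Rightarrow> (nat \<Rightarrow> nat \<Rightarrow> real) \<Rightarrow> (nat \<Rightarrow> nat \<Rightarrow> real \<times> real \<Rightarrow> real) \<Rightarrow> bool"
  where "admissible_ifs N M X Y Z s q \<longleftrightarrow>
    (\<forall>i\<in>{1..N}. \<forall>j\<in>{1..M}.
       \<bar>s i j\<bar> < 1 \<and> continuous_on (grid_rect N M X Y) (q i j) \<and>
       (\<forall>k\<in>{0, N}. \<forall>l\<in>{0, M}. q i j (X k, Y l) = Z (rho i k) (rho j l) - s i j * Z k l))"

text \<open>The matching conditions are kept apart from \<open>admissible_ifs\<close>: the slopes of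
  consecutive \<open>u\<^sub>i\<close> have opposite signs, so with scaling \<open>\<alpha> a\<^sub>i\<close> the first condition
  cannot hold for all \<open>z\<close> unless \<open>\<alpha> = 0\<close>.\<close>

definition matching ::
  "nat \<Rightarrow> nat \<Rightarrow> (nat \<Rightarrow> real) \<Rightarrow> (nat \<Rightarrow> real) \<Rightarrow> (nat \<Rightarrow> nat \<Rightarrow> real \<times> real \<times> real \<Rightarrow> real) \<Rightarrow> bool"
  where "matching N M X Y F \<longleftrightarrow>
    (\<forall>i\<in>{1..<N}. \<forall>j\<in>{1..M}. \<forall>y\<in>{Y 0..Y M}. \<forall>z.
       let x' = inv_into {X 0..X N} (grid_map N X i) (X i)
       in F i j (x', y, z) = F (i + 1) j (x', y, z)) \<and>
    (\<forall>i\<in>{1..N}. \<forall>j\<in>{1..<M}. \<forall>x\<in>{X 0..X N}. \<forall>z.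
       let y' = inv_into {Y 0..Y M} (grid_map M Y j) (Y j)
       in F i j (x, y', z) = F i (j + 1) (x, y', z))"

definition surface :: "(real \<times> real) set \<Rightarrow> (real \<times> real \<Rightarrow> real) \<Rightarrow> (real \<times> real \<times> real) set" where
  "surface D f = {(x, y, f (x, y)) | x y. (x, y) \<in> D}"

definition invariant_interpolant ::
  "nat \<Rightarrow> nat \<Rightarrow> (nat \<Rightarrow> real) \<Rightarrow> (nat \<Rightarrow> real) \<Rightarrow> (nat \<Rightarrow> nat \<Rightarrow> real)
   \<Rightarrow> (nat \<Rightarrow> nat \<Rightarrow> real \<times> real \<times> real \<Rightarrow> real) \<Rightarrow> (real \<times> real \<Rightarrow> real) \<Rightarrow> bool"
  where "invariant_interpolant N M X Y Z F f \<longleftrightarrow>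
    continuous_on (grid_rect N M X Y) f \<and>
    (\<forall>i\<in>{0..N}. \<forall>j\<in>{0..M}. f (X i, Y j) = Z i j) \<and>
    surface (grid_rect N M X Y) f =
      (\<Union>i\<in>{1..N}. \<Union>j\<in>{1..M}. ifs_map N M X Y F i j ` surface (grid_rect N M X Y) f)"

text \<open>HOL functions are total, so uniqueness is uniqueness of the restriction to the rectangle.\<close>

definition is_FIF ::
  "nat \<Rightarrow> nat \<Rightarrow> (nat \<Rightarrow> real) \<Rightarrow> (nat \<Rightarrow> real) \<Rightarrow> (nat \<Rightarrow> nat \<Rightarrow> real)
   \<Rightarrow> (nat \<Rightarrow> nat \<Rightarrow> real \<times> real \<times> real \<Rightarrow> real) \<Rightarrow> (real \<times> real \<Rightarrow> real) \<Rightarrow> bool"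
  where "is_FIF N M X Y Z F f \<longleftrightarrow>
    invariant_interpolant N M X Y Z F f \<and>
    (\<forall>g. invariant_interpolant N M X Y Z F g \<longrightarrow> (\<forall>p\<in>grid_rect N M X Y. g p = f p))"

definition Ix :: "real \<Rightarrow> (real \<times> real \<Rightarrow> real) \<Rightarrow> real \<times> real \<Rightarrow> real" where
  "Ix a g = (\<lambda>(x, y). integral {a..x} (\<lambda>s. g (s, y)))"

definition qhat ::
  "real \<Rightarrow> nat \<Rightarrow> nat \<Rightarrow> (nat \<Rightarrow> real) \<Rightarrow> (nat \<Rightarrow> real) \<Rightarrow> (nat \<Rightarrow> nat \<Rightarrow> real \<times> real \<Rightarrow> real)
   \<Rightarrow> (real \<times> real \<Rightarrow> real) \<Rightarrow> nat \<Rightarrow> nat \<Rightarrow> real \<times> real \<Rightarrow> real"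
  where "qhat a N M X Y q f i j =
    (\<lambda>(x, y). grid_slope N X i * Ix a (q i j) (x, y)
             + integral {a..grid_map N X i a} (\<lambda>s. f (s, grid_map M Y j y)))"

end

theory Submission
  imports Defs
begin

text \<open>Substituting \<open>s = u\<^sub>i(t)\<close> in the integral and using the functional equation of \<open>f\<close>
  gives the functional equation of \<open>I\<^sub>xf\<close>, from which the new \<open>q\<^sub>i\<^sub>j\<close> inherits its
  continuity and its corner values.  The difference \<open>h\<close> of two solutions satisfies
  \<open>h(u\<^sub>i(x), v\<^sub>j(y)) = \<alpha> a\<^sub>i h(x, y)\<close> with \<open>\<bar>\<alpha> a\<^sub>i\<bar> < 1\<close>, so \<open>\<bar>h\<bar>\<close> vanishes at its maximum,
  because the images of the maps \<open>(u\<^sub>i, v\<^sub>j)\<close> cover the rectangle.\<close>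

section \<open>Grids and the affine maps onto their cells\<close>

lemma grid_mono:
  assumes "grid a b N X" "i \<le> j" "j \<le> N"
  shows "X i \<le> X j"
proof -
  have "X i \<le> X j"
    using assms(2)
  proof (induction rule: dec_induct)
    case (step n)
    with assms(1,3) have "X n < X (Suc n)" unfolding grid_def by simp
    with step show ?case by linarith
  qed simp
  then show ?thesis .
qed

lemma grid_less:
  assumes "grid a b N X"
  shows "a < b"
  using grid_mono[OF assms, of 1 N] assms unfolding grid_def by force

lemma grid_cover:
  assumes "grid a b N X" "t \<in> {a..b}"
  obtains i where "i \<in> {1..N}" "t \<in> {X (i - 1)..X i}"
proof -
  \<comment> \<open>Minimality puts the preceding node to the left of \<open>t\<close>, except when
    \<open>i = 1\<close>, where that node is the endpoint \<open>a\<close>. The bound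
    \<open>1 \<le> i\<close> makes \<open>i - 1\<close> a true predecessor.\<close>
  define i where "i = (LEAST i. 1 \<le> i \<and> t \<le> X i)"
  have N: "1 \<le> N \<and> t \<le> X N"
    using assms by (auto simp: grid_def)
  have i: "1 \<le> i \<and> t \<le> X i"
    unfolding i_def by (rule LeastI[of _ N]) (rule N)
  have "i \<le> N"
    unfolding i_def by (rule Least_le) (rule N)
  moreover have "X (i - 1) \<le> t"
  proof (cases "i = 1")
    case True
    then show ?thesis using assms by (auto simp: grid_def)
  next
    case False
    with i have "i - 1 < i" "1 \<le> i - 1" by auto
    then show ?thesis
      using not_less_Least[of "i - 1" "\<lambda>i. 1 \<le> i \<and> t \<le> X i"] unfolding i_def[symmetric] by auto
  qed
  ultimately show thesis using that i by auto
qed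

text \<open>This is what \<open>rho\<close> encodes: the node hit by each end of the interval, in
  either orientation. Hence the corner conditions on \<open>q\<close> are the functional equation
  evaluated at the corners of the rectangle.\<close>

lemma grid_map_endpoint:
  assumes "grid a b N X" "k \<in> {0, N}"
  shows "grid_map N X i (X k) = X (rho i k)"
proof -
  have "X N - X 0 \<noteq> 0" "N \<noteq> 0"
    using grid_less[OF assms(1)] assms(1) by (auto simp: grid_def)
  then show ?thesis
    using assms(2)
    by (auto simp: grid_map_def grid_slope_def grid_icpt_def rho_def divide_simps)
       (simp_all add: algebra_simps)
qed

text \<open>A cell is at most as long as the whole interval. Equality occurs for
  \<open>N = 1\<close>, so strict contraction must later come from \<alpha>.\<close>

lemma abs_grid_slope_le_1:
  assumes "grid a b N X" "i \<in> {1..N}"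
  shows "\<bar>grid_slope N X i\<bar> \<le> 1"
proof -
  have "X 0 \<le> X (i - 1)" "X (i - 1) \<le> X i" "X i \<le> X N" "X 0 < X N"
    using grid_mono[OF assms(1)] grid_less[OF assms(1)] assms by (auto simp: grid_def)
  then show ?thesis
    by (auto simp: grid_slope_def abs_if divide_simps)
qed

lemma grid_map_image:
  assumes "grid a b N X" "i \<in> {1..N}"
  shows "grid_map N X i ` {a..b} = {X (i - 1)..X i}"
proof -
  have ab: "X 0 = a" "X N = b" "a < b" "X (i - 1) \<le> X i"
    using grid_less[OF assms(1)] grid_mono[OF assms(1), of "i - 1" i] assms by (auto simp: grid_def)
  have "N \<noteq> 0" using assms by auto
  then have e: "grid_map N X i a = X (rho i 0)" "grid_map N X i b = X (rho i N)"
    using grid_map_endpoint[OF assms(1), of 0 i] grid_map_endpoint[OF assms(1), of N i] ab by auto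
  have "grid_map N X i ` {a..b} = (\<lambda>t. grid_slope N X i * t + grid_icpt N X i) ` {a..b}"
    by (simp add: grid_map_def)
  \<comment> \<open>An affine image of an interval is spanned by the images of its ends. For even
    \<open>i\<close> the slope is not positive and the two ends swap.\<close>
  also have "\<dots> = {X (i - 1)..X i}"
    using e ab \<open>N \<noteq> 0\<close>
    by (auto simp: image_affinity_atLeastAtMost grid_map_def rho_def grid_slope_def divide_simps split: if_splits)
  finally show ?thesis .
qed

lemma grid_map_mem:
  assumes "grid a b N X" "i \<in> {1..N}" "t \<in> {a..b}"
  shows "grid_map N X i t \<in> {a..b}"
proof -
  have "grid_map N X i t \<in> {X (i - 1)..X i}"
    unfolding grid_map_image[OF assms(1,2), symmetric] using assms(3) by (rule imageI)
  moreover have "X 0 \<le> X (i - 1)" "X i \<le> X N"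
    using grid_mono[OF assms(1)] assms(2) by auto
  ultimately show ?thesis using assms(1) by (auto simp: grid_def)
qed

lemma grid_map_surj:
  assumes "grid a b N X" "t \<in> {a..b}"
  obtains i s where "i \<in> {1..N}" "s \<in> {a..b}" "t = grid_map N X i s"
proof -
  obtain i where i: "i \<in> {1..N}" "t \<in> {X (i - 1)..X i}"
    using grid_cover[OF assms] .
  then have "t \<in> grid_map N X i ` {a..b}"
    by (simp only: grid_map_image[OF assms(1)])
  with i that show thesis by blast
qed

lemma continuous_on_grid_map [continuous_intros]:
  "continuous_on S g \<Longrightarrow> continuous_on S (\<lambda>p. grid_map N X i (g p))"
  unfolding grid_map_def by (intro continuous_intros)

section \<open>Invariant graphs and functional equations\<close>

lemma grid_rect_eq: "grid a b N X \<Longrightarrow> grid c d M Y \<Longrightarrow> grid_rect N M X Y = {a..b} \<times> {c..d}"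
  by (auto simp: grid_rect_def grid_def)

text \<open>A graph has one point over each base point, so a mapped point that lies on the graph
  must carry the value of \<open>f\<close> there. Conversely, the cells cover the rectangle, so each
  point of the graph is the image of another one. Since \<open>F\<close> is arbitrary, this serves
  both the original and the integrated system.\<close>

lemma surface_eq_iff:
  assumes "grid a b N X" "grid c d M Y"
  shows "surface (grid_rect N M X Y) f =
      (\<Union>i\<in>{1..N}. \<Union>j\<in>{1..M}. ifs_map N M X Y F i j ` surface (grid_rect N M X Y) f) \<longleftrightarrow>
    (\<forall>i\<in>{1..N}. \<forall>j\<in>{1..M}. \<forall>x\<in>{a..b}. \<forall>y\<in>{c..d}.
       f (grid_map N X i x, grid_map M Y j y) = F i j (x, y, f (x, y)))"
    (is "?S = ?U \<longleftrightarrow> ?R")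
proof
  assume eq: "?S = ?U"
  show ?R
  proof (intro ballI)
    fix i j x y
    assume ij: "i \<in> {1..N}" "j \<in> {1..M}" and xy: "x \<in> {a..b}" "y \<in> {c..d}"
    then have "(x, y, f (x, y)) \<in> ?S"
      by (auto simp: surface_def grid_rect_eq[OF assms])
    then have "ifs_map N M X Y F i j (x, y, f (x, y)) \<in> ?S"
      using eq ij by blast
    then show "f (grid_map N X i x, grid_map M Y j y) = F i j (x, y, f (x, y))"
      by (auto simp: surface_def ifs_map_def)
  qed
next
  assume R: ?R
  show "?S = ?U"
  proof
    show "?S \<subseteq> ?U"
    proof
      fix p assume "p \<in> ?S"
      then obtain x y where p: "p = (x, y, f (x, y))" "x \<in> {a..b}" "y \<in> {c..d}"
        by (auto simp: surface_def grid_rect_eq[OF assms])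
      obtain i s where i: "i \<in> {1..N}" "s \<in> {a..b}" "x = grid_map N X i s"
        using grid_map_surj[OF assms(1) p(2)] .
      obtain j t where j: "j \<in> {1..M}" "t \<in> {c..d}" "y = grid_map M Y j t"
        using grid_map_surj[OF assms(2) p(3)] .
      have "p = ifs_map N M X Y F i j (s, t, f (s, t))"
        using R i j p by (simp add: ifs_map_def)
      moreover have "(s, t, f (s, t)) \<in> ?S"
        using i j by (auto simp: surface_def grid_rect_eq[OF assms])
      ultimately show "p \<in> ?U" using i j by blast
    qed
    show "?U \<subseteq> ?S"
      using R grid_map_mem[OF assms(1)] grid_map_mem[OF assms(2)]
      by (auto simp: surface_def ifs_map_def grid_rect_eq[OF assms])
  qed
qed

section \<open>Integration in the first variable\<close>

lemma continuous_on_Ix: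
  assumes "continuous_on ({a..b} \<times> T) g"
  shows "continuous_on ({a..b} \<times> T) (Ix a g)"
proof -
  \<comment> \<open>Substituting \<open>s = a + t * (x - a)\<close> moves the variable endpoint into
    the integrand. The range becomes the fixed interval \<open>{0..1}\<close>, where continuity of
    parametric integrals applies. The substitution degenerates at \<open>x = a\<close>, where both
    sides are 0.\<close>
  have scale: "Ix a g p = (fst p - a) * integral {0..1} (\<lambda>t. g (a + t * (fst p - a), snd p))"
    if p: "p \<in> {a..b} \<times> T" for p
  proof (cases "fst p = a")
    case True
    then show ?thesis by (simp add: Ix_def case_prod_beta)
  next
    case False
    define m where "m = fst p - a"
    have m: "m > 0" using False p by (auto simp: m_def)
    have "continuous_on {a..fst p} (\<lambda>s. g (s, snd p))"
      using p by (intro continuous_on_compose2[OF assms] continuous_intros) auto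
    then have "((\<lambda>s. g (s, snd p)) has_integral Ix a g p) {a..fst p}"
      by (auto simp: Ix_def case_prod_beta intro!: integrable_integral integrable_continuous_interval)
    from has_integral_affinity'[of _ _ a "fst p" m a, unfolded cbox_interval, OF this m] m
    have "((\<lambda>t. g (m * t + a, snd p)) has_integral Ix a g p / m) {0..1}"
      by (simp add: m_def divide_inverse mult.commute)
    then show ?thesis
      using m by (auto simp: m_def add.commute mult.commute dest!: integral_unique)
  qed
  have "continuous_on (({a..b} \<times> T) \<times> cbox 0 1)
          (\<lambda>z. g (a + snd z * (fst (fst z) - a), snd (fst z)))"
  proof (rule continuous_on_compose2[OF assms])
    have "a + t * (x - a) \<le> b" if "0 \<le> t" "t \<le> 1" "a \<le> x" "x \<le> b" for x t
      using that mult_left_le_one_le[of "x - a" t] by simp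
    then show "(\<lambda>z. (a + snd z * (fst (fst z) - a), snd (fst z))) ` (({a..b} \<times> T) \<times> cbox 0 1)
        \<subseteq> {a..b} \<times> T"
      by auto
  qed (intro continuous_intros)
  then have "continuous_on ({a..b} \<times> T)
      (\<lambda>p. integral (cbox 0 1) (\<lambda>t. g (a + t * (fst p - a), snd p)))"
    by (intro integral_continuous_on_param) (simp add: case_prod_beta)
  then have "continuous_on ({a..b} \<times> T)
      (\<lambda>p. (fst p - a) * integral {0..1} (\<lambda>t. g (a + t * (fst p - a), snd p)))"
    by (intro continuous_intros) simp
  then show ?thesis
    using scale by (simp cong: continuous_on_cong)
qed

text \<open>Differentiating an antiderivative along the affine map works for either sign of
  \<open>m\<close>, as the orientation-reversing maps require. Because the antiderivative starts at
  \<open>a\<close>, its value at the image of \<open>a\<close> remains as a boundary term.\<close>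

lemma integral_affine_substitution:
  fixes h :: "real \<Rightarrow> real"
  assumes h: "continuous_on {a..b} h" and x: "x \<in> {a..b}"
    and u: "\<And>t. t \<in> {a..b} \<Longrightarrow> m * t + k \<in> {a..b}"
  shows "integral {a..m * x + k} h =
    m * integral {a..x} (\<lambda>t. h (m * t + k)) + integral {a..m * a + k} h"
proof -
  define H where "H = (\<lambda>s. integral {a..s} h)"
  have "((\<lambda>t. m * h (m * t + k)) has_integral H (m * x + k) - H (m * a + k)) {a..x}"
  proof (rule fundamental_theorem_of_calculus)
    fix t assume "t \<in> {a..x}"
    with x have t: "t \<in> {a..b}" by auto
    have "(H has_real_derivative h (m * t + k)) (at (m * t + k) within {a..b})"
      unfolding H_def by (rule integral_has_real_derivative[OF h u[OF t]])
    \<comment> \<open>At the ends of \<open>{a..b}\<close> only a one-sided derivative of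
      \<open>H\<close> is available. The chain rule is therefore applied relative to the image of
      \<open>{a..x}\<close>, which stays inside \<open>{a..b}\<close>.\<close>
    then have "(H has_real_derivative h (m * t + k))
        (at (m * t + k) within (\<lambda>t. m * t + k) ` {a..x})"
      by (rule DERIV_subset) (use u x in auto)
    then have "(H \<circ> (\<lambda>t. m * t + k) has_real_derivative h (m * t + k) * m) (at t within {a..x})"
      by (rule DERIV_image_chain) (auto intro!: derivative_eq_intros)
    then show "((\<lambda>t. H (m * t + k)) has_vector_derivative m * h (m * t + k)) (at t within {a..x})"
      by (simp add: has_real_derivative_iff_has_vector_derivative o_def mult.commute)
  qed (use x in auto)
  then have "integral {a..x} (\<lambda>t. m * h (m * t + k)) = H (m * x + k) - H (m * a + k)"
    by (rule integral_unique)
  then show ?thesis by (simp add: H_def)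
qed

lemma Ix_functional_equation:
  assumes gX: "grid a b N X" and gY: "grid c d M Y"
    and f: "continuous_on ({a..b} \<times> {c..d}) f" and q: "continuous_on ({a..b} \<times> {c..d}) (q i j)"
    and eq: "\<And>x y. x \<in> {a..b} \<Longrightarrow> y \<in> {c..d} \<Longrightarrow>
      f (grid_map N X i x, grid_map M Y j y) = \<alpha> * f (x, y) + q i j (x, y)"
    and ij: "i \<in> {1..N}" "j \<in> {1..M}" and xy: "x \<in> {a..b}" "y \<in> {c..d}"
  shows "Ix a f (grid_map N X i x, grid_map M Y j y) =
    \<alpha> * grid_slope N X i * Ix a f (x, y) + qhat a N M X Y q f i j (x, y)"
proof -
  have slice: "continuous_on {a..b} (\<lambda>s. f (s, y))" "continuous_on {a..b} (\<lambda>s. q i j (s, y))"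
    "continuous_on {a..b} (\<lambda>s. f (s, grid_map M Y j y))"
    using xy grid_map_mem[OF gY ij(2) xy(2)]
    by (auto intro!: continuous_on_compose2[OF f] continuous_on_compose2[OF q] continuous_intros)
  have int: "(\<lambda>s. f (s, y)) integrable_on {a..x}" "(\<lambda>s. \<alpha> * f (s, y)) integrable_on {a..x}"
    "(\<lambda>s. q i j (s, y)) integrable_on {a..x}"
    using slice xy
    by (auto intro!: integrable_continuous_interval continuous_on_mult_left elim: continuous_on_subset)
  have "integral {a..x} (\<lambda>t. f (grid_map N X i t, grid_map M Y j y)) =
        integral {a..x} (\<lambda>t. \<alpha> * f (t, y) + q i j (t, y))"
    using xy by (intro integral_cong) (auto simp: eq)
  also have "\<dots> = \<alpha> * Ix a f (x, y) + Ix a (q i j) (x, y)"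
    using int by (simp add: Ix_def integral_add)
  \<comment> \<open>The substitution is applied to the slice of \<open>f\<close> at height
    \<open>grid_map M Y j y\<close>. The slope multiplies both integrals just found, and the
    boundary term is the second summand of \<open>qhat\<close>.\<close>
  finally show ?thesis
    using integral_affine_substitution[OF slice(3) xy(1),
        of "grid_slope N X i" "grid_icpt N X i"] grid_map_mem[OF gX ij(1)]
    by (simp add: Ix_def qhat_def grid_map_def[of N X] algebra_simps)
qed

section \<open>Uniqueness for the functional equation\<close>

lemma functional_equation_unique:
  fixes f g :: "real \<times> real \<Rightarrow> real"
  assumes gX: "grid a b N X" and gY: "grid c d M Y"
    and f: "continuous_on ({a..b} \<times> {c..d}) f" and g: "continuous_on ({a..b} \<times> {c..d}) g"
    and s: "\<And>i j. i \<in> {1..N} \<Longrightarrow> j \<in> {1..M} \<Longrightarrow> \<bar>s i j\<bar> < 1"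
    and eqf: "\<And>i j x y. i \<in> {1..N} \<Longrightarrow> j \<in> {1..M} \<Longrightarrow> x \<in> {a..b} \<Longrightarrow> y \<in> {c..d} \<Longrightarrow>
      f (grid_map N X i x, grid_map M Y j y) = s i j * f (x, y) + q i j (x, y)"
    and eqg: "\<And>i j x y. i \<in> {1..N} \<Longrightarrow> j \<in> {1..M} \<Longrightarrow> x \<in> {a..b} \<Longrightarrow> y \<in> {c..d} \<Longrightarrow>
      g (grid_map N X i x, grid_map M Y j y) = s i j * g (x, y) + q i j (x, y)"
    and p: "p \<in> {a..b} \<times> {c..d}"
  shows "g p = f p"
proof -
  have "continuous_on ({a..b} \<times> {c..d}) (\<lambda>p. \<bar>g p - f p\<bar>)"
    by (intro continuous_intros f g)
  moreover have "compact ({a..b} \<times> {c..d})" "{a..b} \<times> {c..d} \<noteq> {}"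
    using p by (auto intro: compact_Times)
  ultimately obtain P where P: "P \<in> {a..b} \<times> {c..d}"
    and sup: "\<And>p. p \<in> {a..b} \<times> {c..d} \<Longrightarrow> \<bar>g p - f p\<bar> \<le> \<bar>g P - f P\<bar>"
    using continuous_attains_sup[of "{a..b} \<times> {c..d}" "\<lambda>p. \<bar>g p - f p\<bar>"] by blast
  have "fst P \<in> {a..b}" "snd P \<in> {c..d}"
    using P by auto
  obtain i x where i: "i \<in> {1..N}" "x \<in> {a..b}" "fst P = grid_map N X i x"
    using grid_map_surj[OF gX \<open>fst P \<in> {a..b}\<close>] .
  obtain j y where j: "j \<in> {1..M}" "y \<in> {c..d}" "snd P = grid_map M Y j y"
    using grid_map_surj[OF gY \<open>snd P \<in> {c..d}\<close>] .
  have P_eq: "P = (grid_map N X i x, grid_map M Y j y)"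
    using i(3) j(3) by (simp add: prod_eq_iff)
  have "g P - f P = s i j * (g (x, y) - f (x, y))"
    unfolding P_eq eqf[OF i(1) j(1) i(2) j(2)] eqg[OF i(1) j(1) i(2) j(2)]
    by (simp add: algebra_simps)
  \<comment> \<open>The difference at the preimage \<open>(x, y)\<close> of \<open>P\<close> is
    itself bounded by the maximum, attained at \<open>P\<close>. As the factor is below 1, a
    positive maximum is impossible.\<close>
  then have "\<bar>g P - f P\<bar> \<le> \<bar>s i j\<bar> * \<bar>g P - f P\<bar>"
    using sup[of "(x, y)"] i(2) j(2) by (simp add: abs_mult mult_left_mono)
  then have "g P - f P = 0"
    using s[OF i(1) j(1)] mult_less_cancel_right2[of "\<bar>s i j\<bar>" "\<bar>g P - f P\<bar>"] by force
  with sup[OF p] show ?thesis by simp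
qed

section \<open>The integrated system\<close>

theorem theorem4p1:
  fixes a b c d \<alpha> :: real
    and N M :: nat
    and X Y :: "nat \<Rightarrow> real"
    and Z :: "nat \<Rightarrow> nat \<Rightarrow> real"
    and q :: "nat \<Rightarrow> nat \<Rightarrow> real \<times> real \<Rightarrow> real"
    and f :: "real \<times> real \<Rightarrow> real"
  assumes "grid a b N X" and "grid c d M Y"
    and "\<bar>\<alpha>\<bar> < 1"
    and "admissible_ifs N M X Y Z (\<lambda>i j. \<alpha>) q"
    and "matching N M X Y (vert_map (\<lambda>i j. \<alpha>) q)"
    and "is_FIF N M X Y Z (vert_map (\<lambda>i j. \<alpha>) q) f"
  shows "admissible_ifs N M X Y (\<lambda>i j. Ix a f (X i, Y j))
           (\<lambda>i j. \<alpha> * grid_slope N X i) (qhat a N M X Y q f) \<and>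
         is_FIF N M X Y (\<lambda>i j. Ix a f (X i, Y j))
           (vert_map (\<lambda>i j. \<alpha> * grid_slope N X i) (qhat a N M X Y q f)) (Ix a f)"
proof -
  note gX = assms(1) and gY = assms(2)
  let ?R = "{a..b} \<times> {c..d}"
  let ?s = "\<lambda>i j::nat. \<alpha> * grid_slope N X i" and ?q = "qhat a N M X Y q f"
  let ?u = "grid_map N X" and ?v = "grid_map M Y" and ?Z = "\<lambda>i j. Ix a f (X i, Y j)"
  note R = grid_rect_eq[OF gX gY] and surf = surface_eq_iff[OF gX gY, unfolded grid_rect_eq[OF gX gY]]
  have f: "continuous_on ?R f"
    and eqf: "\<forall>i\<in>{1..N}. \<forall>j\<in>{1..M}. \<forall>x\<in>{a..b}. \<forall>y\<in>{c..d}.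
      f (?u i x, ?v j y) = \<alpha> * f (x, y) + q i j (x, y)"
    using assms(6) unfolding is_FIF_def invariant_interpolant_def surf R
    by (simp_all add: vert_map_def)
  have q: "continuous_on ?R (q i j)" if "i \<in> {1..N}" "j \<in> {1..M}" for i j
    using assms(4) that by (auto simp: admissible_ifs_def R)
  have eq: "Ix a f (?u i x, ?v j y) = ?s i j * Ix a f (x, y) + ?q i j (x, y)"
    if "i \<in> {1..N}" "j \<in> {1..M}" "x \<in> {a..b}" "y \<in> {c..d}" for i j x y
    by (rule Ix_functional_equation[where b = b and c = c and d = d]) (use gX gY f q eqf that in auto)
  have cont: "continuous_on ?R (Ix a f)"
    using f by (rule continuous_on_Ix)
  have s: "\<bar>?s i j\<bar> < 1" if "i \<in> {1..N}" for i j
    using abs_grid_slope_le_1[OF gX that] assms(3) mult_left_le[of "\<bar>grid_slope N X i\<bar>" "\<bar>\<alpha>\<bar>"]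
    by (simp add: abs_mult)
  have "admissible_ifs N M X Y ?Z ?s ?q"
    unfolding admissible_ifs_def R
  proof (intro ballI conjI)
    fix i j assume ij: "i \<in> {1..N}" "j \<in> {1..M}"
    show "\<bar>?s i j\<bar> < 1" by (rule s[OF ij(1)])
    \<comment> \<open>Solving the functional equation for \<open>qhat\<close> expresses it through
      \<open>Ix a f\<close> alone. Its continuity thus needs no separate study of the integral whose
      integrand varies with the height.\<close>
    have "continuous_on ?R (\<lambda>p. Ix a f (?u i (fst p), ?v j (snd p)) - ?s i j * Ix a f p)"
      using grid_map_mem[OF gX ij(1)] grid_map_mem[OF gY ij(2)]
      by (intro continuous_intros cont continuous_on_compose2[OF cont]) auto
    then show "continuous_on ?R (?q i j)"
      by (rule continuous_on_eq) (use eq[OF ij] in auto)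
    fix k l assume kl: "k \<in> {0, N}" "l \<in> {0, M}"
    then have "X k \<in> {a..b}" "Y l \<in> {c..d}"
      using gX gY grid_less[OF gX] grid_less[OF gY] by (auto simp: grid_def)
    \<comment> \<open>The cell maps send the corner to the node with indices \<open>rho i k\<close>
      and \<open>rho j l\<close>, where the new data are the values of
      \<open>Ix a f\<close>.\<close>
    from eq[OF ij this]
    show "?q i j (X k, Y l) = ?Z (rho i k) (rho j l) - ?s i j * ?Z k l"
      by (simp add: grid_map_endpoint[OF gX kl(1)] grid_map_endpoint[OF gY kl(2)])
  qed
  \<comment> \<open>Interpolation holds because the data are read off from \<open>Ix a f\<close>.
    Invariance is \<open>eq\<close>, so uniqueness is what remains to be argued.\<close>
  moreover have "is_FIF N M X Y ?Z (vert_map ?s ?q) (Ix a f)"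
    unfolding is_FIF_def invariant_interpolant_def surf R
  proof (intro conjI allI impI ballI)
    fix g p
    assume g: "continuous_on ?R g \<and> (\<forall>i\<in>{0..N}. \<forall>j\<in>{0..M}. g (X i, Y j) = ?Z i j) \<and>
      (\<forall>i\<in>{1..N}. \<forall>j\<in>{1..M}. \<forall>x\<in>{a..b}. \<forall>y\<in>{c..d}.
         g (?u i x, ?v j y) = vert_map ?s ?q i j (x, y, g (x, y)))"
      and p: "p \<in> ?R"
    show "g p = Ix a f p"
      by (rule functional_equation_unique[OF gX gY cont _ _ _ _ p, of g ?s ?q])
         (use g s eq in \<open>auto simp: vert_map_def\<close>)
  qed (use cont eq in \<open>auto simp: vert_map_def\<close>)
  ultimately show ?thesis by blast
qed

end
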